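(* For every $\lambda > 0$ there is a constant $C_\lambda>0$ such that for every integer $d\ge 1$ and every $d$-regular graph $G$ on $N$ vertices, $$ P(\lambda, G) \leq (1+\lambda)^{\frac{N}{2}}\, 2^{\frac{N}{2d}\left(1+C_\lambda\sqrt{\frac{\log d}{d}}\right)}. $$
   Context: Graphs are simple, finite and undirected. An independent set of $G$ is a set of vertices no two of which are adjacent; $\mathcal{I}(G)$ is the set of independent sets of $G$ (including the empty set). The independent set polynomial is $P(\lambda,G)=\sum_{I \in \mathcal{I}(G)} \lambda^{|I|}$. Here $\log$ denotes the base-2 logarithm. *)

theory Defs
  imports Complex_Main "Graph_Theory.Pair_Digraph"
begin

text \<open>
  A finite simple undirected graph is a \<open>pair_graph\<close>: a finite vertex set with a symmetric,
  irreflexive set of arcs, each undirected edge being represented by its two orientations,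
  so that the degree of a vertex is its out-degree.
\<close>

definition regular_graph :: "nat \<Rightarrow> 'a pair_pre_digraph \<Rightarrow> bool" where
  "regular_graph d G \<longleftrightarrow> pair_graph G \<and> (\<forall>v \<in> pverts G. out_degree (with_proj G) v = d)"

definition independent_sets :: "'a pair_pre_digraph \<Rightarrow> 'a set set" where
  "independent_sets G = {I. I \<subseteq> pverts G \<and> (\<forall>u \<in> I. \<forall>v \<in> I. (u, v) \<notin> parcs G)}"

definition independent_set_polynomial :: "real \<Rightarrow> 'a pair_pre_digraph \<Rightarrow> real" where
  "independent_set_polynomial x G = (\<Sum>I \<in> independent_sets G. x ^ card I)"

end

theory Submission
  imports Defs "HOL-Analysis.Convex"
begin

text \<open>
  The bound holds with \<open>C = 1\<close>, and in fact without the error term: for a \<open>d\<close>-regular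
  graph \<open>P(\<lambda>, G)\<^sup>2\<close> is at most \<open>2 (1 + \<lambda>)\<^sup>d - 1\<close> to the power \<open>N / d\<close>, the bound of Kahn,
  Galvin, Tetali and Zhao.  By Zhao's swapping argument \<open>P(\<lambda>, G)\<^sup>2\<close> is at most the sum of
  \<open>\<lambda>\<close> to the power \<open>\<bar>A\<bar> + \<bar>B\<bar>\<close> over all pairs of vertex sets without an edge from \<open>A\<close> to \<open>B\<close>.
  For fixed \<open>A\<close> the sum over \<open>B\<close> is a product over the vertices \<open>v\<close> of factors that depend only
  on the trace of \<open>A\<close> on the neighbourhood of \<open>v\<close>.  Every vertex lies in exactly \<open>d\<close>
  neighbourhoods, so a Hoelder inequality of Finner type bounds the total by a product of
  sums over the subsets of single neighbourhoods.
\<close>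

section \<open>Superadditivity of geometric means\<close>

lemma real_root_prod: "root d (\<Prod>i\<in>K. f i) = (\<Prod>i\<in>K. root d (f i))" if "d > 0"
  using that by (induction K rule: infinite_finite_induct) (auto simp: real_root_mult)

lemma prod_root_le_mean:
  fixes a :: "'a \<Rightarrow> real"
  assumes "finite K" "K \<noteq> {}" "\<And>k. k \<in> K \<Longrightarrow> a k \<ge> 0"
  shows "(\<Prod>k\<in>K. root (card K) (a k)) \<le> (\<Sum>k\<in>K. a k) / card K"
proof -
  have c: "card K > 0" using assms by (simp add: card_gt_0_iff)
  have "(\<Prod>k\<in>K. root (card K) (a k)) = (\<Prod>k\<in>K. a k) powr (1 / card K)"
    unfolding real_root_prod[OF c, symmetric]
    using c assms(3) by (intro root_powr_inverse prod_nonneg) auto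
  also have "\<dots> \<le> (\<Sum>k\<in>K. a k) / card K"
    using arith_geom_mean[OF assms] by (simp add: sum_divide_distrib)
  finally show ?thesis .
qed

text \<open>Hoelder's inequality on two points with \<open>card K\<close> equal exponents. Dividing
  the \<open>k\<close>-th factors by \<open>a k + b k\<close> turns the right side into 1, and the
  arithmetic means that bound the two terms on the left then add up to 1.\<close>

lemma prod_root_add_le:
  fixes a b :: "'a \<Rightarrow> real"
  assumes fin: "finite K" and ne: "K \<noteq> {}"
    and a: "\<And>k. k \<in> K \<Longrightarrow> a k \<ge> 0" and b: "\<And>k. k \<in> K \<Longrightarrow> b k \<ge> 0"
  shows "(\<Prod>k\<in>K. root (card K) (a k)) + (\<Prod>k\<in>K. root (card K) (b k))
       \<le> (\<Prod>k\<in>K. root (card K) (a k + b k))"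
proof (cases "\<exists>k\<in>K. a k + b k = 0")
  \<comment> \<open>Normalising would divide by zero here, but all three products vanish.\<close>
  case True
  then obtain k where k: "k \<in> K" "a k + b k = 0" by blast
  with a[of k] b[of k] have "a k = 0" "b k = 0" by auto
  moreover have "(\<Prod>k\<in>K. root (card K) (f k)) = 0" if "f k = 0" for f :: "'a \<Rightarrow> real"
    using fin k(1) that by (intro prod_zero bexI[of _ k]) auto
  ultimately show ?thesis using k by simp
next
  case False
  define s where "s k = a k + b k" for k
  have s: "s k > 0" if "k \<in> K" for k
  proof -
    have "a k + b k \<noteq> 0" using False that by blast
    with a[OF that] b[OF that] show ?thesis by (simp add: s_def)
  qed
  have c: "card K > 0" using fin ne by (simp add: card_gt_0_iff)
  let ?S = "\<Prod>k\<in>K. root (card K) (s k)"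
  have S: "?S > 0" using s c by (intro prod_pos) auto
  have split: "(\<Prod>k\<in>K. root (card K) (f k)) = (\<Prod>k\<in>K. root (card K) (f k / s k)) * ?S" for f
  proof -
    have "root (card K) (f k) = root (card K) (f k / s k) * root (card K) (s k)" if "k \<in> K" for k
      using s[OF that] by (subst real_root_mult[symmetric]) simp
    then have "(\<Prod>k\<in>K. root (card K) (f k))
        = (\<Prod>k\<in>K. root (card K) (f k / s k) * root (card K) (s k))"
      by (rule prod.cong[OF refl])
    then show ?thesis by (simp only: prod.distrib)
  qed
  have "(\<Prod>k\<in>K. root (card K) (a k / s k)) + (\<Prod>k\<in>K. root (card K) (b k / s k))
      \<le> (\<Sum>k\<in>K. a k / s k) / card K + (\<Sum>k\<in>K. b k / s k) / card K"
    by (intro add_mono prod_root_le_mean fin ne) (use a b s in \<open>auto intro!: divide_nonneg_pos\<close>)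
  also have "\<dots> = (\<Sum>k\<in>K. a k / s k + b k / s k) / card K"
    by (simp add: sum.distrib add_divide_distrib)
  also have "(\<Sum>k\<in>K. a k / s k + b k / s k) = (\<Sum>k\<in>K. 1)"
  proof (rule sum.cong[OF refl])
    fix k assume "k \<in> K"
    with s[of k] have "s k \<noteq> 0" by simp
    then show "a k / s k + b k / s k = 1"
      unfolding add_divide_distrib[symmetric] by (simp flip: s_def)
  qed
  also have "(\<Sum>k\<in>K. 1) / real (card K) = 1" using c by simp
  finally have "((\<Prod>k\<in>K. root (card K) (a k / s k)) + (\<Prod>k\<in>K. root (card K) (b k / s k))) * ?S
      \<le> 1 * ?S"
    using S by (intro mult_right_mono) auto
  then show ?thesis
    unfolding distrib_right split[of a, symmetric] split[of b, symmetric] by (simp add: s_def)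
qed

text \<open>The two points stand for a vertex being absent or present, presence having weight
  \<open>x\<close>. The weight moves into the factors because \<open>x\<close> is the product of
  \<open>card K\<close> copies of its root.\<close>

lemma prod_root_add_mult_le:
  fixes a b :: "'a \<Rightarrow> real"
  assumes "finite K" "K \<noteq> {}" "x \<ge> 0"
    and "\<And>k. k \<in> K \<Longrightarrow> a k \<ge> 0" and "\<And>k. k \<in> K \<Longrightarrow> b k \<ge> 0"
  shows "(\<Prod>k\<in>K. root (card K) (a k)) + x * (\<Prod>k\<in>K. root (card K) (b k))
       \<le> (\<Prod>k\<in>K. root (card K) (a k + x * b k))"
proof -
  have "x * (\<Prod>k\<in>K. root (card K) (b k)) = (\<Prod>k\<in>K. root (card K) (x * b k))"
    using assms(1-3) by (simp add: real_root_mult prod.distrib card_gt_0_iff)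
  with prod_root_add_le[of K a "\<lambda>k. x * b k"] assms show ?thesis by simp
qed

section \<open>Summing out vertices: a Finner-type inequality\<close>

lemma sum_Pow_insert:
  fixes f :: "'a set \<Rightarrow> 'b::comm_monoid_add"
  assumes "finite V" "v \<notin> V"
  shows "(\<Sum>A\<in>Pow (insert v V). f A) = (\<Sum>A\<in>Pow V. f A + f (insert v A))"
proof -
  have "(\<Sum>A\<in>Pow (insert v V). f A) = (\<Sum>A\<in>Pow V. f A) + (\<Sum>A\<in>insert v ` Pow V. f A)"
    unfolding Pow_insert by (rule sum.union_disjoint) (use assms in auto)
  also have "(\<Sum>A\<in>insert v ` Pow V. f A) = (\<Sum>A\<in>Pow V. f (insert v A))"
    by (subst sum.reindex) (use assms in \<open>auto intro!: inj_onI\<close>)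
  finally show ?thesis by (simp add: sum.distrib)
qed

text \<open>
  Stated for the \<open>d\<close>-th powers \<open>h j\<close> of the factors, so that the induction on \<open>V\<close>
  can integrate out a vertex without taking powers of roots.
\<close>

lemma finner_inequality:
  fixes h :: "'j \<Rightarrow> 'a set \<Rightarrow> real"
  assumes "finite V" "finite J" "d > 0" "x \<ge> 0"
    and "\<And>j. j \<in> J \<Longrightarrow> S j \<subseteq> V"
    and "\<And>v. v \<in> V \<Longrightarrow> card {j \<in> J. v \<in> S j} = d"
    and "\<And>j A. j \<in> J \<Longrightarrow> h j A \<ge> 0"
  shows "(\<Sum>A\<in>Pow V. x ^ card A * (\<Prod>j\<in>J. root d (h j (A \<inter> S j))))
       \<le> (\<Prod>j\<in>J. root d (\<Sum>A\<in>Pow (S j). x ^ card A * h j A))"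
  using assms
proof (induction V arbitrary: S h rule: finite_induct)
  case empty
  then have "S j = {}" if "j \<in> J" for j using that by blast
  then show ?case by simp
next
  case (insert v V)
  define K where "K = {j \<in> J. v \<in> S j}"
  define S' where "S' j = S j - {v}" for j
  \<comment> \<open>The sum over absence and weighted presence of \<open>v\<close>, taken in each
    factor that sees \<open>v\<close>. The other factors do not depend on \<open>v\<close>, and the
    covering number of every other vertex stays \<open>d\<close>.\<close>
  define h' where "h' j A = (if v \<in> S j then h j A + x * h j (insert v A) else h j A)" for j A
  have K: "K \<subseteq> J" "finite K" "card K = d"
    using insert.prems by (auto simp: K_def)
  have Kne: "K \<noteq> {}" using K insert.prems by auto
  have h'0: "h' j A \<ge> 0" if "j \<in> J" for j A
    using insert.prems(6)[OF that] \<open>x \<ge> 0\<close> by (simp add: h'_def)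
  have step: "x ^ card A * (\<Prod>j\<in>J. root d (h j (A \<inter> S j)))
      + x ^ card (insert v A) * (\<Prod>j\<in>J. root d (h j (insert v A \<inter> S j)))
      \<le> x ^ card A * (\<Prod>j\<in>J. root d (h' j (A \<inter> S' j)))" (is "?l \<le> ?r")
    if A: "A \<in> Pow V" for A
  proof -
    have vA: "v \<notin> A" and fA: "finite A"
      using A insert.hyps by (auto intro: finite_subset)
    have AS: "A \<inter> S' j = A \<inter> S j" for j using vA by (auto simp: S'_def)
    have J: "(\<Prod>j\<in>J. g j) = (\<Prod>j\<in>J - K. g j) * (\<Prod>j\<in>K. g j)" for g :: "'j \<Rightarrow> real"
      using prod.subset_diff[OF K(1) \<open>finite J\<close>] .
    let ?R = "\<Prod>j\<in>J - K. root d (h j (A \<inter> S j))"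
    have R0: "?R \<ge> 0"
      using insert.prems by (intro prod_nonneg) auto
    have 1: "(\<Prod>j\<in>J - K. root d (h j (insert v A \<inter> S j))) = ?R"
      by (intro prod.cong) (auto simp: K_def)
    have 2: "(\<Prod>j\<in>J - K. root d (h' j (A \<inter> S' j))) = ?R"
      by (intro prod.cong) (auto simp: K_def h'_def AS)
    have 3: "(\<Prod>j\<in>K. root d (h j (insert v A \<inter> S j))) = (\<Prod>j\<in>K. root d (h j (insert v (A \<inter> S j))))"
      by (intro prod.cong) (auto simp: K_def)
    have 4: "(\<Prod>j\<in>K. root d (h' j (A \<inter> S' j)))
        = (\<Prod>j\<in>K. root d (h j (A \<inter> S j) + x * h j (insert v (A \<inter> S j))))"
      by (intro prod.cong) (auto simp: K_def h'_def AS)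
    have "?l = x ^ card A * ?R * ((\<Prod>j\<in>K. root d (h j (A \<inter> S j)))
            + x * (\<Prod>j\<in>K. root d (h j (insert v (A \<inter> S j)))))"
      unfolding J 1 3 using vA fA by (simp add: algebra_simps)
    also have "\<dots> \<le> x ^ card A * ?R *
        (\<Prod>j\<in>K. root d (h j (A \<inter> S j) + x * h j (insert v (A \<inter> S j))))"
    proof (rule mult_left_mono)
      show "(\<Prod>j\<in>K. root d (h j (A \<inter> S j))) + x * (\<Prod>j\<in>K. root d (h j (insert v (A \<inter> S j))))
          \<le> (\<Prod>j\<in>K. root d (h j (A \<inter> S j) + x * h j (insert v (A \<inter> S j))))"
        \<comment> \<open>Exactly \<open>d\<close> factors see \<open>v\<close>, so the
          \<open>d\<close>-th roots are the roots of order \<open>card K\<close> that Hoelder's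
          inequality needs.\<close>
        by (rule prod_root_add_mult_le[OF K(2) Kne \<open>x \<ge> 0\<close>, unfolded K(3)])
          (use K(1) insert.prems(6) in auto)
      show "0 \<le> x ^ card A * ?R" using R0 \<open>x \<ge> 0\<close> by simp
    qed
    also have "\<dots> = ?r" unfolding J 2 4 by simp
    finally show ?thesis .
  qed
  have "(\<Sum>A\<in>Pow (insert v V). x ^ card A * (\<Prod>j\<in>J. root d (h j (A \<inter> S j))))
      \<le> (\<Sum>A\<in>Pow V. x ^ card A * (\<Prod>j\<in>J. root d (h' j (A \<inter> S' j))))"
    unfolding sum_Pow_insert[OF insert.hyps] by (intro sum_mono step)
  also have "\<dots> \<le> (\<Prod>j\<in>J. root d (\<Sum>A\<in>Pow (S' j). x ^ card A * h' j A))"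
  proof (rule insert.IH)
    fix u assume u: "u \<in> V"
    then have "{j \<in> J. u \<in> S' j} = {j \<in> J. u \<in> S j}"
      using insert.hyps by (auto simp: S'_def)
    then show "card {j \<in> J. u \<in> S' j} = d" using insert.prems(5) u by simp
  qed (use insert.prems(1-3) insert.prems(4) h'0 in \<open>auto simp: S'_def\<close>)
  also have "\<dots> = (\<Prod>j\<in>J. root d (\<Sum>A\<in>Pow (S j). x ^ card A * h j A))"
  proof (intro prod.cong refl arg_cong[where f = "root d"])
    fix j assume j: "j \<in> J"
    show "(\<Sum>A\<in>Pow (S' j). x ^ card A * h' j A) = (\<Sum>A\<in>Pow (S j). x ^ card A * h j A)"
    proof (cases "v \<in> S j")
      case True
      have fS: "finite (S' j)"
        using insert.prems(4)[OF j] insert.hyps(1) by (auto simp: S'_def intro: finite_subset)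
      have nv: "v \<notin> S' j" and Sj: "S j = insert v (S' j)" using True by (auto simp: S'_def)
      show ?thesis
        unfolding Sj sum_Pow_insert[OF fS nv]
      proof (intro sum.cong refl)
        fix A assume "A \<in> Pow (S' j)"
        then have "finite A" "v \<notin> A" using fS nv by (auto intro: finite_subset)
        then show "x ^ card A * h' j A
            = x ^ card A * h j A + x ^ card (insert v A) * h j (insert v A)"
          using True by (simp add: h'_def algebra_simps)
      qed
    next
      case False
      then show ?thesis by (simp add: S'_def h'_def)
    qed
  qed
  finally show ?case .
qed

section \<open>Generating functions of set pairs and the swapping argument\<close>

lemma sum_power_card_Pow:
  fixes x :: real
  assumes "finite V"
  shows "(\<Sum>A\<in>Pow V. x ^ card A) = (1 + x) ^ card V"
  using prod_add[OF assms, of "\<lambda>_. x" "\<lambda>_. 1"] by (simp add: add.commute)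

text \<open>
  Pairs are grouped by intersection and union.  Given one pair \<open>(A\<^sub>0, B\<^sub>0)\<close> of independent
  sets, both it and \<open>(A, B)\<close> induce proper 2-colourings of the symmetric difference of \<open>A\<close>
  and \<open>B\<close>, so their difference is constant along edges.
\<close>

lemma card_independent_pairs_le:
  fixes E :: "'a rel"
  assumes "finite V"
  defines "P \<equiv> {(A, B). A \<subseteq> V \<and> B \<subseteq> V \<and> A \<times> A \<inter> E = {} \<and> B \<times> B \<inter> E = {}}"
  defines "Q \<equiv> {(A, B). A \<subseteq> V \<and> B \<subseteq> V \<and> A \<times> B \<inter> E = {}}"
  shows "card {(A, B) \<in> P. A \<inter> B = C \<and> A \<union> B = U} \<le> card {(A, B) \<in> Q. A \<inter> B = C \<and> A \<union> B = U}"
    (is "card ?P \<le> card ?Q")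
proof (cases "?P = {}")
  case True
  then show ?thesis by (simp only: card.empty le0)
next
  case False
  then obtain A0 B0 where 0: "(A0, B0) \<in> P" "A0 \<inter> B0 = C" "A0 \<union> B0 = U" by auto
  define X where "X A = (A - A0) \<union> (A0 - A)" for A
  define \<phi> where "\<phi> = (\<lambda>(A, B :: 'a set). (C \<union> X A, U - X A))"
  have "inj_on \<phi> ?P"
  proof (rule inj_onI)
    fix p q assume "p \<in> ?P" "q \<in> ?P" "\<phi> p = \<phi> q"
    moreover obtain A B A' B' where pq: "p = (A, B)" "q = (A', B')" by fastforce
    ultimately have *: "A \<inter> B = C" "A \<union> B = U" "A' \<inter> B' = C" "A' \<union> B' = U" "C \<union> X A = C \<union> X A'"
      by (auto simp: \<phi>_def)
    \<comment> \<open>Disjointness from \<open>C\<close> lets \<open>X A\<close> be read off the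
      first component of the image. It determines \<open>A\<close> through \<open>A0\<close>, and
      then \<open>B\<close> through the common intersection and union.\<close>
    have "X A \<inter> C = {}" "X A' \<inter> C = {}" using * 0 by (auto simp: X_def)
    with * have "X A = X A'" by blast
    then have "A = A'" by (auto simp: X_def)
    moreover from this * have "B = B'" by blast
    ultimately show "p = q" by (simp add: pq)
  qed
  moreover have "\<phi> ` ?P \<subseteq> ?Q"
  proof (rule image_subsetI)
    fix p assume "p \<in> ?P"
    then obtain A B where p: "p = (A, B)" and AB: "(A, B) \<in> P" and C: "C = A \<inter> B" and U: "U = A \<union> B"
      by auto
    define A' B' where "A' = C \<union> X A" and "B' = U - X A"
    have A': "A' = (A \<inter> B) \<union> X A" and B': "B' = (A \<union> B) - X A"
      by (simp_all add: A'_def B'_def C U)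
    have eq: "A0 \<inter> B0 = A \<inter> B" "A0 \<union> B0 = A \<union> B" using 0 C U by simp_all
    have X: "X A \<subseteq> A \<union> B" "X A \<inter> (A \<inter> B) = {}" using eq by (auto simp: X_def)
    have "(u, v) \<notin> E" if "u \<in> A'" "v \<in> B'" for u v
    proof
      assume "(u, v) \<in> E"
      then have "\<not> (u \<in> D \<and> v \<in> D)" if "D \<in> {A, B, A0, B0}" for D
        using that AB 0(1) by (auto simp: P_def)
      then have "\<not> (u \<in> A \<and> v \<in> A)" "\<not> (u \<in> B \<and> v \<in> B)"
        "\<not> (u \<in> A0 \<and> v \<in> A0)" "\<not> (u \<in> B0 \<and> v \<in> B0)"
        by simp_all
      moreover have "w \<in> A0 \<and> w \<in> B0 \<longleftrightarrow> w \<in> A \<and> w \<in> B"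
        "w \<in> A0 \<or> w \<in> B0 \<longleftrightarrow> w \<in> A \<or> w \<in> B" for w
        using eq by blast+
      note this[of u] this[of v]
      \<comment> \<open>If \<open>u\<close> lies in both \<open>A\<close> and \<open>B\<close>, then
        \<open>v\<close> shares one of them with \<open>u\<close>. Otherwise \<open>v\<close> lies
        in both \<open>A\<close> and \<open>A0\<close>, or in both \<open>B\<close> and
        \<open>B0\<close>; independence then forces \<open>A\<close> and \<open>A0\<close> to agree
        at \<open>u\<close>, where they differ.\<close>
      moreover have "u \<in> A \<and> u \<in> B \<or> (u \<in> A \<longleftrightarrow> u \<notin> A0)"
        "(v \<in> A \<or> v \<in> B) \<and> (v \<in> A \<longleftrightarrow> v \<in> A0)"
        using that by (auto simp: A' B' X_def)
      ultimately show False by argo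
    qed
    then have "(A', B') \<in> Q"
      using AB X unfolding Q_def P_def A' B' by blast
    moreover have "A' \<inter> B' = C" "A' \<union> B' = U" using X by (auto simp: A' B' C U)
    ultimately show "\<phi> p \<in> ?Q" by (simp add: \<phi>_def p A'_def B'_def)
  qed
  moreover have "finite ?Q"
    by (rule finite_subset[of _ "Pow V \<times> Pow V"]) (use assms(1) in \<open>auto simp: Q_def\<close>)
  ultimately show ?thesis by (rule card_inj_on_le)
qed

text \<open>The weight of a pair depends only on its intersection and union, since
  \<open>card A + card B\<close> equals the sum of their cardinalities. Comparing the numbers of
  pairs in each fibre of \<open>key\<close> is therefore enough.\<close>

lemma sum_independent_squared_le:
  fixes E :: "'a rel" and x :: real
  assumes V: "finite V" and x: "x \<ge> 0"
  shows "(\<Sum>A | A \<subseteq> V \<and> A \<times> A \<inter> E = {}. x ^ card A)\<^sup>2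
       \<le> (\<Sum>A\<in>Pow V. x ^ card A * (\<Sum>B | B \<subseteq> V \<and> A \<times> B \<inter> E = {}. x ^ card B))"
proof -
  let ?I = "{A. A \<subseteq> V \<and> A \<times> A \<inter> E = {}}"
  define P where "P = {(A, B). A \<subseteq> V \<and> B \<subseteq> V \<and> A \<times> A \<inter> E = {} \<and> B \<times> B \<inter> E = {}}"
  define Q where "Q = {(A, B). A \<subseteq> V \<and> B \<subseteq> V \<and> A \<times> B \<inter> E = {}}"
  define key where "key = (\<lambda>(A :: 'a set, B). (A \<inter> B, A \<union> B))"
  define w where "w = (\<lambda>(A :: 'a set, B :: 'a set). x ^ (card A + card B))"
  have fin: "finite P" "finite Q"
    by (rule finite_subset[of _ "Pow V \<times> Pow V"]; use V in \<open>auto simp: P_def Q_def\<close>)+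
  have w: "w p = w (key p)" if "p \<in> Pow V \<times> Pow V" for p
  proof -
    obtain A B where p: "p = (A, B)" by fastforce
    with that V have "finite A" "finite B" by (auto intro: finite_subset)
    then show ?thesis using card_Un_Int[of A B] by (simp add: p w_def key_def add.commute)
  qed
  have fibres: "sum w R = (\<Sum>k\<in>Pow V \<times> Pow V. card {p \<in> R. key p = k} * w k)"
    if "finite R" "R \<subseteq> Pow V \<times> Pow V" for R
  proof -
    have "sum w R = (\<Sum>k\<in>Pow V \<times> Pow V. sum w {p \<in> R. key p = k})"
      by (rule sum.group[symmetric]) (use that V in \<open>auto simp: key_def\<close>)
    also have "\<dots> = (\<Sum>k\<in>Pow V \<times> Pow V. \<Sum>p | p \<in> R \<and> key p = k. w k)"
      by (intro sum.cong) (use w that in auto)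
    finally show ?thesis by simp
  qed
  have "(\<Sum>A\<in>?I. x ^ card A)\<^sup>2 = (\<Sum>A\<in>?I. \<Sum>B\<in>?I. x ^ (card A + card B))"
    by (simp add: power2_eq_square sum_product power_add)
  also have "\<dots> = sum w P"
    unfolding sum.cartesian_product by (intro sum.cong) (auto simp: w_def P_def)
  also have "\<dots> = (\<Sum>k\<in>Pow V \<times> Pow V. card {p \<in> P. key p = k} * w k)"
    by (rule fibres) (use fin in \<open>auto simp: P_def\<close>)
  also have "\<dots> \<le> (\<Sum>k\<in>Pow V \<times> Pow V. card {p \<in> Q. key p = k} * w k)"
  proof (intro sum_mono mult_right_mono)
    fix k
    have "{p \<in> R. key p = k} = {(A, B) \<in> R. A \<inter> B = fst k \<and> A \<union> B = snd k}" for R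
      by (auto simp: key_def)
    then show "real (card {p \<in> P. key p = k}) \<le> real (card {p \<in> Q. key p = k})"
      unfolding P_def Q_def of_nat_le_iff by (simp only: card_independent_pairs_le[OF V])
  qed (use x in \<open>auto simp: w_def\<close>)
  also have "\<dots> = sum w Q"
    by (rule fibres[symmetric]) (use fin in \<open>auto simp: Q_def\<close>)
  also have "\<dots> = (\<Sum>(A, B)\<in>(SIGMA A:Pow V. {B. B \<subseteq> V \<and> A \<times> B \<inter> E = {}}). x ^ card A * x ^ card B)"
    by (intro sum.cong) (auto simp: w_def Q_def power_add)
  also have "\<dots> = (\<Sum>A\<in>Pow V. x ^ card A * (\<Sum>B | B \<subseteq> V \<and> A \<times> B \<inter> E = {}. x ^ card B))"
    by (subst sum.Sigma[symmetric]) (use V in \<open>auto simp: sum_distrib_left\<close>)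
  finally show ?thesis .
qed

section \<open>Factorisation over vertices and the bound for regular graphs\<close>

text \<open>The admissible \<open>B\<close> are precisely the subsets of the set of vertices with no
  neighbour in \<open>A\<close>, so each vertex chooses independently.\<close>

lemma sum_separated_eq_prod:
  fixes E :: "'a rel" and x :: real
  assumes V: "finite V" and A: "A \<subseteq> V"
  shows "(\<Sum>B | B \<subseteq> V \<and> A \<times> B \<inter> E = {}. x ^ card B)
       = (\<Prod>v\<in>V. if A \<inter> {u \<in> V. (u, v) \<in> E} = {} then 1 + x else 1)"
proof -
  let ?W = "{v \<in> V. A \<inter> {u \<in> V. (u, v) \<in> E} = {}}"
  have "{B. B \<subseteq> V \<and> A \<times> B \<inter> E = {}} = Pow ?W" using A by blast
  then have "(\<Sum>B | B \<subseteq> V \<and> A \<times> B \<inter> E = {}. x ^ card B) = (\<Prod>v\<in>?W. 1 + x)"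
    using sum_power_card_Pow[of ?W x] V by simp
  then show ?thesis using V by (simp only: prod.inter_filter)
qed

text \<open>The radicand is the independent set polynomial of the complete bipartite graph with
  sides of size \<open>d\<close>: an independent set is a subset of one side, and the empty set is
  counted twice.\<close>

lemma independent_set_polynomial_le:
  fixes x :: real
  assumes x: "x \<ge> 0" and d: "d \<ge> 1" and G: "regular_graph d G"
  shows "(independent_set_polynomial x G)\<^sup>2 \<le> root d (2 * (1 + x) ^ d - 1) ^ card (pverts G)"
proof -
  interpret pair_graph G using G by (simp add: regular_graph_def)
  let ?V = "pverts G" and ?E = "parcs G"
  have V: "finite ?V" by (rule pair_finite_verts)
  define N where "N v = {u \<in> ?V. (u, v) \<in> ?E}" for v
  have sym: "(u, v) \<in> ?E \<longleftrightarrow> (v, u) \<in> ?E" for u v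
    using pair_sym_arcs by (auto simp: symmetric_def dest: symD)
  have N: "card (N v) = d" if "v \<in> ?V" for v
  proof -
    have "out_arcs (with_proj G) v = Pair v ` N v"
      using in_arcsD2 sym by (auto simp: N_def out_arcs_def)
    moreover have "card (Pair v ` N v) = card (N v)" by (rule card_image) (auto intro: inj_onI)
    ultimately have "out_degree (with_proj G) v = card (N v)" by (simp only: out_degree_def)
    then show ?thesis using G that by (simp add: regular_graph_def)
  qed
  \<comment> \<open>By symmetry the neighbourhoods containing \<open>u\<close> are those of its
    neighbours, which gives the covering number \<open>d\<close>.\<close>
  have N': "{v \<in> ?V. u \<in> N v} = N u" if "u \<in> ?V" for u
    using that sym by (auto simp: N_def)
  \<comment> \<open>The \<open>d\<close>-th power of the factor of a vertex, as a function of the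
    trace of \<open>A\<close> on its neighbourhood.\<close>
  define h where "h = (\<lambda>A :: 'a set. if A = {} then (1 + x) ^ d else 1)"
  have h: "root d (h A) = (if A = {} then 1 + x else 1)" for A
    using d x by (simp add: h_def real_root_power_cancel)
  have norm: "(\<Sum>A\<in>Pow (N v). x ^ card A * h A) = 2 * (1 + x) ^ d - 1" if "v \<in> ?V" for v
  proof -
    have fN: "finite (N v)" using V by (simp add: N_def)
    \<comment> \<open>Every trace has factor 1 apart from the empty one, whose excess is split
      off.\<close>
    have "(\<Sum>A\<in>Pow (N v). x ^ card A * h A)
        = (\<Sum>A\<in>Pow (N v). x ^ card A + (if A = {} then (1 + x) ^ d - 1 else 0))"
      by (intro sum.cong) (auto simp: h_def)
    also have "\<dots> = (1 + x) ^ d + ((1 + x) ^ d - 1)"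
      unfolding sum.distrib using fN N[OF that] by (simp add: sum_power_card_Pow)
    finally show ?thesis by simp
  qed
  have "independent_sets G = {A. A \<subseteq> ?V \<and> A \<times> A \<inter> ?E = {}}"
    by (auto simp: independent_sets_def)
  then have "(independent_set_polynomial x G)\<^sup>2
      \<le> (\<Sum>A\<in>Pow ?V. x ^ card A * (\<Sum>B | B \<subseteq> ?V \<and> A \<times> B \<inter> ?E = {}. x ^ card B))"
    using sum_independent_squared_le[OF V x, of ?E] by (simp add: independent_set_polynomial_def)
  also have "\<dots> = (\<Sum>A\<in>Pow ?V. x ^ card A * (\<Prod>v\<in>?V. root d (h (A \<inter> N v))))"
    by (intro sum.cong refl arg_cong2[where f = "(*)"])
      (auto simp: sum_separated_eq_prod[OF V] h N_def)
  also have "\<dots> \<le> (\<Prod>v\<in>?V. root d (\<Sum>A\<in>Pow (N v). x ^ card A * h A))"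
    by (rule finner_inequality) (use V d x N N' in \<open>auto simp: h_def N_def\<close>)
  also have "\<dots> = root d (2 * (1 + x) ^ d - 1) ^ card ?V"
    using norm by simp
  finally show ?thesis .
qed

section \<open>Derivation of the stated bound\<close>

theorem theorem1p3:
  fixes lam :: real
  assumes "lam > 0"
  shows "\<exists>C::real. C > 0 \<and>
    (\<forall>(d::nat) (G :: 'a pair_pre_digraph). d \<ge> 1 \<longrightarrow> regular_graph d G \<longrightarrow>
      independent_set_polynomial lam G
        \<le> (1 + lam) powr (real (card (pverts G)) / 2)
          * 2 powr (real (card (pverts G)) / (2 * real d)
                     * (1 + C * sqrt (log 2 (real d) / real d))))"
proof (intro exI[of _ 1] conjI allI impI)
  fix d :: nat and G :: "'a pair_pre_digraph"
  assume d: "d \<ge> 1" and G: "regular_graph d G"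
  let ?n = "card (pverts G)"
  let ?R = "(1 + lam) powr (?n / 2) * 2 powr (?n / (2 * real d))"
  \<comment> \<open>This keeps the radicand nonnegative, as monotonicity of powers requires when the
    \<open>- 1\<close> is dropped.\<close>
  have "1 \<le> (1 + lam) ^ d" using assms by (intro one_le_power) simp
  then have "root d (2 * (1 + lam) ^ d - 1) ^ ?n \<le> root d (2 * (1 + lam) ^ d) ^ ?n"
    using d by (intro power_mono) auto
  also have "root d (2 * (1 + lam) ^ d) = 2 powr (1 / d) * (1 + lam)"
    using d assms root_powr_inverse[of d 2] by (simp add: real_root_mult real_root_power_cancel)
  also have "(2 powr (1 / d) * (1 + lam)) ^ ?n = ?R\<^sup>2"
  proof -
    have "((1 + lam) powr (?n / 2))\<^sup>2 = (1 + lam) ^ ?n"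
      using assms by (simp add: powr_power powr_realpow)
    moreover have "(2 powr (?n / (2 * real d)))\<^sup>2 = (2 powr (1 / d)) ^ ?n"
      by (simp add: powr_power)
    ultimately show ?thesis by (simp only: power_mult_distrib mult.commute)
  qed
  finally have "(independent_set_polynomial lam G)\<^sup>2 \<le> ?R\<^sup>2"
    using independent_set_polynomial_le[of lam d G] assms d G by simp
  then have "independent_set_polynomial lam G \<le> ?R"
    by (rule power2_le_imp_le) simp
  also have "\<dots> \<le> (1 + lam) powr (?n / 2)
      * 2 powr (?n / (2 * real d) * (1 + 1 * sqrt (log 2 d / d)))"
  proof (intro mult_left_mono powr_mono)
    \<comment> \<open>The logarithm is nonnegative for \<open>d \<ge> 1\<close>, so the error term
      only enlarges the exponent.\<close>
    have "1 \<le> 1 + 1 * sqrt (log 2 d / d)" using d by simp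
    from mult_left_mono[OF this, of "?n / (2 * real d)"]
    show "?n / (2 * real d) \<le> ?n / (2 * real d) * (1 + 1 * sqrt (log 2 d / d))" by simp
  qed (use assms in auto)
  finally show "independent_set_polynomial lam G
      \<le> (1 + lam) powr (real ?n / 2)
        * 2 powr (real ?n / (2 * real d) * (1 + 1 * sqrt (log 2 (real d) / real d)))" .
qed simp

end
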